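(* Let $f\in\mathcal{U}$ with Taylor expansion $f(z)=z+a_2z^2+a_3z^3+\cdots$ in $\mathbb{D}$, and suppose $a_2=0$. Let $H_2(4)(f)=a_4a_6-a_5^2$. Then $|H_2(4)(f)|\le 1$, and the estimate is sharp due to the function $f(z)=\frac{z}{1-z^2}=z+z^3+z^5+z^7+\cdots$ (which belongs to $\mathcal{U}$, has $a_2=0$, and attains equality).
   Context: $\mathbb{D}=\{z\in\mathbb{C}:|z|<1\}$. $\mathcal{A}$ is the class of functions $f$ analytic in $\mathbb{D}$ and normalized by $f(0)=0$, $f'(0)=1$, i.e. $f(z)=z+a_2z^2+a_3z^3+\cdots$. The class $\mathcal{U}$ is $$\mathcal{U}=\left\{f\in\mathcal{A}:\left|\left[\frac{z}{f(z)}\right]^2f'(z)-1\right|<1,\ z\in\mathbb{D}\right\},$$ where $z/f(z)$ is understood to have the value $1$ at $z=0$ (and membership includes that $f(z)\neq0$ for $0<|z|<1$, so that the expression is defined). For a function $f\in\mathcal{A}$ the second order Hankel determinant is $H_2(n)(f)=a_na_{n+2}-a_{n+1}^2$. *)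

theory Defs
  imports "HOL-Complex_Analysis.Complex_Analysis"
begin

definition class_A :: "(complex \<Rightarrow> complex) set" where
  "class_A = {f. f analytic_on ball 0 1 \<and> f 0 = 0 \<and> deriv f 0 = 1}"

(* z / f z at the origin has its continuous value 1; plain division would give 0 there. *)
definition id_over :: "(complex \<Rightarrow> complex) \<Rightarrow> complex \<Rightarrow> complex" where
  "id_over f z = (if z = 0 then 1 else z / f z)"

(* Nonvanishing off the origin is required explicitly because division by zero is total here. *)
definition class_U :: "(complex \<Rightarrow> complex) set" where
  "class_U = {f \<in> class_A.
     (\<forall>z\<in>ball 0 1 - {0}. f z \<noteq> 0) \<and>
     (\<forall>z\<in>ball 0 1. norm ((id_over f z)\<^sup>2 * deriv f z - 1) < 1)}"

definition taylor_coeff :: "(complex \<Rightarrow> complex) \<Rightarrow> nat \<Rightarrow> complex" where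
  "taylor_coeff f n = fps_nth (fps_expansion f 0) n"

definition hankel2 :: "nat \<Rightarrow> (complex \<Rightarrow> complex) \<Rightarrow> complex" where
  "hankel2 n f = taylor_coeff f n * taylor_coeff f (n + 2) - (taylor_coeff f (n + 1))\<^sup>2"

end

theory Submission
  imports Defs
begin

text \<open>
  Everything is read off from the reciprocal function \<open>p z = z / f z\<close>, which is holomorphic on
  the disc because \<open>f\<close> has its only zero, a simple one, at the origin. Differentiating \<open>f z * p z = z\<close> turns the
  expression defining the class into something linear in \<open>p\<close>, namely
  \<open>(p z)\<^sup>2 * deriv f z = p z - z * deriv p z\<close> (\<open>class_U_expression\<close>). If \<open>p\<close> has coefficients
  \<open>p\<^sub>n\<close>, then \<open>w z = p z - z * deriv p z - 1\<close> has coefficients \<open>(1 - n) * p\<^sub>n\<close> for \<open>n \<ge> 1\<close>; it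
  is bounded by 1 and vanishes to second order at 0. Applying Schwarz's lemma twice gives
  \<open>w z = z\<^sup>2 * v z\<close> with \<open>v\<close> still bounded by 1.

  The coefficients \<open>d\<^sub>n\<close> of such a \<open>v\<close> satisfy \<open>|d\<^sub>0| \<le> 1\<close> and
  \<open>|d\<^sub>n| \<le> 1 - |d\<^sub>0|\<^sup>2\<close> for \<open>n \<ge> 1\<close> (\<open>norm_fps_nth_le\<close>). When \<open>a\<^sub>2 = 0\<close>, also \<open>p\<^sub>1 = 0\<close>, and
  inverting the power series of \<open>p\<close> expresses the determinant through them:
  \<open>a\<^sub>4 = d\<^sub>1 / 2\<close>, \<open>a\<^sub>5 = d\<^sub>2 / 3 + d\<^sub>0\<^sup>2\<close>, \<open>a\<^sub>6 = d\<^sub>3 / 4 + d\<^sub>0 * d\<^sub>1\<close>.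
  With \<open>s = 1 - |d\<^sub>0|\<^sup>2\<close> the triangle inequality bounds
  \<open>|a\<^sub>4 * a\<^sub>6 - a\<^sub>5\<^sup>2|\<close> by a quadratic polynomial in \<open>s\<close> that is at most 1 on \<open>[0, 1]\<close>
  (\<open>hankel_bound\<close>), with equality at \<open>s = 0\<close>. There \<open>|d\<^sub>0| = 1\<close>, so \<open>v\<close> is constant and
  \<open>p z = 1 - d\<^sub>0 * z\<^sup>2\<close>; the choice \<open>d\<^sub>0 = 1\<close> is the extremal function.
\<close>

section \<open>Coefficients of bounded functions on the unit disc\<close>

lemma has_fps_expansion_fps_expansion_unit_disc:
  assumes "f holomorphic_on ball 0 1"
  shows "f has_fps_expansion fps_expansion f 0"
  using assms by (intro has_fps_expansion_fps_expansion[of "ball 0 1"]) auto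

text \<open>
  Cauchy's inequality on the circle of radius \<open>r < 1\<close>, in the limit \<open>r \<rightarrow> 1\<close>.
\<close>

lemma norm_fps_nth_le_1:
  fixes f :: "complex \<Rightarrow> complex"
  assumes hol: "f holomorphic_on ball 0 1"
    and bd: "\<And>z. norm z < 1 \<Longrightarrow> norm (f z) \<le> 1"
    and exp: "f has_fps_expansion F"
  shows "norm (fps_nth F n) \<le> 1"
proof -
  have F: "fps_nth F n = (deriv ^^ n) f 0 / fact n"
    using fps_nth_fps_expansion[OF exp] by simp
  have *: "r ^ n * norm (fps_nth F n) \<le> 1" if r: "0 < r" "r < 1" for r :: real
  proof -
    have "norm ((deriv ^^ n) f 0) \<le> fact n * 1 / r ^ n"
    proof (rule Cauchy_inequality)
      show "f holomorphic_on ball 0 r" using hol by (rule holomorphic_on_subset) (use r in auto)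
      have "f holomorphic_on cball 0 r" using hol by (rule holomorphic_on_subset) (use r in auto)
      then show "continuous_on (cball 0 r) f" by (rule holomorphic_on_imp_continuous_on)
      show "norm (f z) \<le> 1" if "norm (0 - z) = r" for z using that r by (intro bd) auto
    qed (use r in auto)
    then show ?thesis using r by (simp add: F norm_divide divide_simps mult.commute)
  qed
  have "((\<lambda>r. r ^ n * norm (fps_nth F n)) \<longlongrightarrow> 1 ^ n * norm (fps_nth F n)) (at_left (1::real))"
    by (intro tendsto_intros)
  moreover have "\<forall>\<^sub>F r in at_left (1::real). r ^ n * norm (fps_nth F n) \<le> 1"
    by (rule eventually_mono[OF eventually_at_left_real[of 0 1]]) (auto intro: *)
  ultimately have "1 ^ n * norm (fps_nth F n) \<le> 1"
    by (rule tendsto_upperbound) auto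
  then show ?thesis by simp
qed

text \<open>
  Compose \<open>f\<close> with the disc automorphism that sends \<open>c = f 0\<close> to 0. The composition \<open>h\<close> is again
  bounded by 1 and satisfies \<open>(1 - cnj c * f z) * h z = f z - c\<close>. Because \<open>f\<close> has no terms
  strictly between 0 and \<open>n\<close>, comparing coefficients at \<open>n\<close> shows that the coefficient of \<open>f\<close> is
  \<open>1 - |c|\<^sup>2\<close> times that of \<open>h\<close>, and the latter is at most 1 in modulus.
\<close>

lemma norm_fps_nth_le_of_gap:
  fixes f :: "complex \<Rightarrow> complex"
  assumes hol: "f holomorphic_on ball 0 1"
    and bd: "\<And>z. norm z < 1 \<Longrightarrow> norm (f z) < 1"
    and exp: "f has_fps_expansion F"
    and gap: "\<And>j. 0 < j \<Longrightarrow> j < n \<Longrightarrow> fps_nth F j = 0" and n: "0 < n"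
  shows "norm (fps_nth F n) \<le> 1 - (norm (fps_nth F 0))\<^sup>2"
proof -
  define c where "c = fps_nth F 0"
  have c: "c = f 0" using has_fps_expansion_imp_0_eq_fps_nth_0[OF exp] by (simp add: c_def)
  have cn: "norm c < 1" using bd[of 0] by (simp add: c)
  define h where "h = (\<lambda>z. Moebius_function 0 c (f z))"
  have hh: "h holomorphic_on ball 0 1"
    unfolding h_def
    using holomorphic_on_compose_gen[OF hol Moebius_function_holomorphic[OF cn, of 0]] bd
    by (auto simp: o_def image_subset_iff)
  have hb: "norm (h z) \<le> 1" if "norm z < 1" for z
    unfolding h_def using Moebius_function_norm_lt_1[OF cn bd[OF that], of 0] by simp
  define H where "H = fps_expansion h 0"
  have H: "h has_fps_expansion H"
    unfolding H_def using hh by (rule has_fps_expansion_fps_expansion_unit_disc)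
  have H0: "fps_nth H 0 = 0"
    using has_fps_expansion_imp_0_eq_fps_nth_0[OF H]
    by (simp add: h_def c Moebius_function_eq_zero)
  have nz: "1 - cnj c * f z \<noteq> 0" if "norm z < 1" for z
  proof
    assume "1 - cnj c * f z = 0"
    then have "1 = norm c * norm (f z)"
      by (metis complex_mod_cnj eq_iff_diff_eq_0 norm_mult norm_one)
    moreover have "norm c * norm (f z) < 1 * 1"
      using cn bd[OF that] by (intro mult_strict_mono') auto
    ultimately show False by simp
  qed
  have expH: "(\<lambda>z. (1 - cnj c * f z) * h z) has_fps_expansion (1 - fps_const (cnj c) * F) * H"
    by (intro fps_expansion_intros exp H)
  have "\<forall>\<^sub>F z in nhds 0. (1 - cnj c * f z) * h z = f z - c"
  proof -
    have "\<forall>\<^sub>F z in nhds (0::complex). z \<in> ball 0 1" by (rule eventually_nhds_in_open) auto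
    then show ?thesis
      by eventually_elim (use nz in \<open>auto simp: h_def Moebius_function_simple field_simps\<close>)
  qed
  from iffD1[OF has_fps_expansion_cong[OF this refl] expH]
  have "(\<lambda>z. f z - c) has_fps_expansion (1 - fps_const (cnj c) * F) * H" .
  moreover have "(\<lambda>z. f z - c) has_fps_expansion F - fps_const c"
    by (intro fps_expansion_intros exp)
  ultimately have eq: "(1 - fps_const (cnj c) * F) * H = F - fps_const c"
    by (rule fps_expansion_unique_complex)
  \<comment> \<open>In the Cauchy product only the constant term of the first factor contributes: its
      intermediate coefficients vanish, and the last one meets the zero constant term of \<open>H\<close>.\<close>
  have "fps_nth ((1 - fps_const (cnj c) * F) * H) n
      = (\<Sum>i\<in>{0}. fps_nth (1 - fps_const (cnj c) * F) i * fps_nth H (n - i))"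
    unfolding fps_mult_nth
  proof (intro sum.mono_neutral_right ballI)
    fix i assume "i \<in> {0..n} - {0}"
    then show "fps_nth (1 - fps_const (cnj c) * F) i * fps_nth H (n - i) = 0"
      using gap[of i] H0 by (cases "i = n") auto
  qed auto
  also have "\<dots> = (1 - cnj c * c) * fps_nth H n" by (simp add: c_def)
  finally have "fps_nth F n = (1 - cnj c * c) * fps_nth H n"
    using n by (simp add: eq)
  also have "1 - cnj c * c = of_real (1 - (norm c)\<^sup>2)"
    by (metis complex_norm_square mult.commute of_real_1 of_real_diff of_real_power)
  finally have "norm (fps_nth F n) = \<bar>1 - (norm c)\<^sup>2\<bar> * norm (fps_nth H n)"
    by (simp only: norm_mult norm_of_real)
  also have "\<dots> \<le> \<bar>1 - (norm c)\<^sup>2\<bar> * 1"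
    by (intro mult_left_mono norm_fps_nth_le_1[OF hh hb H]) auto
  also have "\<dots> = 1 - (norm c)\<^sup>2" using cn by (simp add: power_le_one)
  finally show ?thesis by (simp add: c_def)
qed

lemma sum_powers_root_of_unity:
  assumes "0 < j" "j < n"
  shows "(\<Sum>k<n. exp (2 * of_real pi * \<i> * of_nat k / of_nat n) ^ j) = (0::complex)"
proof -
  define w where "w = exp (2 * of_real pi * \<i> * of_nat j / of_nat n)"
  have "w \<noteq> 1" unfolding w_def using complex_root_unity_eq_1[of n j] assms by (auto dest: dvd_imp_le)
  moreover have "w ^ n = 1" unfolding w_def using complex_root_unity[of n j] assms by simp
  ultimately have "(\<Sum>k<n. w ^ k) = 0" by (simp add: sum_gp_strict)
  moreover have "exp (2 * of_real pi * \<i> * of_nat k / of_nat n) ^ j = w ^ k" for k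
    unfolding w_def by (simp flip: exp_of_nat_mult add: mult_ac)
  ultimately show ?thesis by simp
qed

text \<open>
  The gap condition is achieved by averaging \<open>f\<close> over rotations by the \<open>n\<close>-th roots of unity:
  this preserves the bound and the coefficients at 0 and \<open>n\<close>, and removes those in between.
\<close>

lemma norm_fps_nth_le_strict:
  fixes f :: "complex \<Rightarrow> complex"
  assumes hol: "f holomorphic_on ball 0 1"
    and bd: "\<And>z. norm z < 1 \<Longrightarrow> norm (f z) < 1"
    and exp: "f has_fps_expansion F" and n: "0 < n"
  shows "norm (fps_nth F n) \<le> 1 - (norm (fps_nth F 0))\<^sup>2"
proof -
  define w where "w = (\<lambda>k. exp (2 * of_real pi * \<i> * of_nat k / of_nat n) :: complex)"
  have w: "norm (w k) = 1" for k by (simp add: w_def norm_exp_eq_Re)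
  have wn: "w k ^ n = 1" for k unfolding w_def using complex_root_unity[of n k] n by simp
  define g where "g = (\<lambda>z. (1 / of_nat n) * (\<Sum>k<n. f (w k * z)))"
  define G where "G = fps_const (1 / of_nat n) * (\<Sum>k<n. F oo (fps_const (w k) * fps_X))"
  have "(\<lambda>z. f (w k * z)) has_fps_expansion (F oo (fps_const (w k) * fps_X))" for k
  proof -
    have "(f \<circ> (\<lambda>z. w k * z)) has_fps_expansion (F oo (fps_const (w k) * fps_X))"
      by (intro has_fps_expansion_compose exp fps_expansion_intros) simp
    then show ?thesis by (simp add: o_def)
  qed
  then have G: "g has_fps_expansion G"
    unfolding g_def G_def by (intro fps_expansion_intros)
  have Gj: "fps_nth G j = (\<Sum>k<n. w k ^ j) * fps_nth F j / of_nat n" for j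
    by (simp add: G_def fps_sum_nth sum_distrib_right)
  have "norm (fps_nth G n) \<le> 1 - (norm (fps_nth G 0))\<^sup>2"
  proof (rule norm_fps_nth_le_of_gap[OF _ _ G _ n])
    have "(\<lambda>z. f (w k * z)) holomorphic_on ball 0 1" for k
      using holomorphic_on_compose_gen[of "\<lambda>z. w k * z" "ball 0 1" f, OF _ hol]
      by (auto simp: o_def image_subset_iff norm_mult w intro!: holomorphic_intros)
    then show "g holomorphic_on ball 0 1" unfolding g_def by (intro holomorphic_intros)
    fix z :: complex assume z: "norm z < 1"
    have "norm (\<Sum>k<n. f (w k * z)) < of_nat (card {..<n}) * 1"
    proof (rule order.strict_trans1[OF norm_sum], rule sum_bounded_above_strict)
      show "norm (f (w k * z)) < 1" for k using z by (intro bd) (simp add: norm_mult w)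
    qed (use n in auto)
    then show "norm (g z) < 1" using n by (simp add: g_def norm_mult norm_divide divide_simps)
  next
    show "fps_nth G j = 0" if "0 < j" "j < n" for j
      using sum_powers_root_of_unity[OF that] by (simp add: Gj w_def)
  qed
  then show ?thesis using n by (simp add: Gj wn)
qed

text \<open>
  Scaling \<open>f\<close> by \<open>r < 1\<close> makes the bound strict; then let \<open>r \<rightarrow> 1\<close>.
\<close>

lemma norm_fps_nth_le:
  fixes f :: "complex \<Rightarrow> complex"
  assumes hol: "f holomorphic_on ball 0 1"
    and bd: "\<And>z. norm z < 1 \<Longrightarrow> norm (f z) \<le> 1"
    and exp: "f has_fps_expansion F" and n: "0 < n"
  shows "norm (fps_nth F n) \<le> 1 - (norm (fps_nth F 0))\<^sup>2"
proof -
  have "norm (fps_nth F n) + (norm (fps_nth F 0))\<^sup>2 \<le> 1"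
  proof (rule field_le_mult_one_interval)
    fix t :: real assume t: "0 < t" "t < 1"
    \<comment> \<open>Scaling by \<open>r\<close> multiplies the squared coefficient by \<open>r\<^sup>2\<close> and the other one by
        \<open>r \<ge> r\<^sup>2\<close>, so the common factor obtained is \<open>r\<^sup>2\<close>.\<close>
    define r where "r = sqrt t"
    have r: "0 < r" "r < 1" "t = r\<^sup>2" using t by (auto simp: r_def)
    have "norm (fps_nth (fps_const (of_real r) * F) n)
        \<le> 1 - (norm (fps_nth (fps_const (of_real r) * F) 0))\<^sup>2"
    proof (rule norm_fps_nth_le_strict[OF _ _ _ n])
      show "(\<lambda>z. of_real r * f z) holomorphic_on ball 0 1" by (intro holomorphic_intros hol)
      show "(\<lambda>z. of_real r * f z) has_fps_expansion fps_const (of_real r) * F"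
        by (intro fps_expansion_intros exp)
      fix z :: complex assume "norm z < 1"
      then have "r * norm (f z) \<le> r * 1" using r by (intro mult_left_mono bd) auto
      then have "r * norm (f z) < 1" using r(2) by linarith
      then show "norm (of_real r * f z) < 1" using r by (simp add: norm_mult)
    qed
    then have "r * norm (fps_nth F n) + r\<^sup>2 * (norm (fps_nth F 0))\<^sup>2 \<le> 1"
      using r by (simp add: norm_mult power_mult_distrib)
    moreover have "r\<^sup>2 * norm (fps_nth F n) \<le> r * norm (fps_nth F n)"
      using r by (intro mult_right_mono) (auto simp: power2_eq_square)
    ultimately show "t * (norm (fps_nth F n) + (norm (fps_nth F 0))\<^sup>2) \<le> 1"
      by (simp add: r distrib_left)
  qed
  then show ?thesis by simp
qed

text \<open>
  Schwarz's lemma in a form that can be iterated: the quotient satisfies the same non-strict bound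
  as \<open>f\<close>, and \<open>g 0 = deriv f 0\<close> tells whether a further factor \<open>z\<close> can be split off. As in
  the previous lemma, the strict inequality that Schwarz's lemma asks for comes from scaling.
\<close>

lemma schwarz_division:
  fixes f :: "complex \<Rightarrow> complex"
  assumes hol: "f holomorphic_on ball 0 1" and f0: "f 0 = 0"
    and bd: "\<And>z. norm z < 1 \<Longrightarrow> norm (f z) \<le> 1"
  obtains g where "g holomorphic_on ball 0 1" "\<And>z. norm z < 1 \<Longrightarrow> norm (g z) \<le> 1"
    "\<And>z. f z = z * g z" "g 0 = deriv f 0"
proof
  define g where "g = (\<lambda>z. if z = 0 then deriv f 0 else f z / z)"
  show "g holomorphic_on ball 0 1"
    using pole_lemma_open[OF hol, of 0] by (simp add: g_def f0 cong: if_cong)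
  show "f z = z * g z" for z by (simp add: g_def f0)
  show "g 0 = deriv f 0" by (simp add: g_def)
  fix z :: complex assume z: "norm z < 1"
  show "norm (g z) \<le> 1"
  proof (rule field_le_mult_one_interval)
    fix r :: real assume r: "0 < r" "r < 1"
    define h where "h = (\<lambda>z. of_real r * f z)"
    have h: "h holomorphic_on ball 0 1" unfolding h_def by (intro holomorphic_intros hol)
    have h0: "h 0 = 0" by (simp add: h_def f0)
    have hb: "norm (h z) < 1" if "norm z < 1" for z
    proof -
      have "r * norm (f z) \<le> r * 1" using r that by (intro mult_left_mono bd) auto
      then have "r * norm (f z) < 1" using r(2) by linarith
      then show ?thesis using r by (simp add: h_def norm_mult)
    qed
    note Schwarz = Schwarz_Lemma[OF h h0 hb z]
    have "f field_differentiable at 0"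
      using hol by (rule holomorphic_on_imp_differentiable_at) auto
    then have "deriv h 0 = of_real r * deriv f 0" by (simp add: h_def)
    then show "r * norm (g z) \<le> 1"
      using Schwarz(1,2) r
      by (cases "z = 0") (auto simp: g_def norm_mult norm_divide h_def divide_simps)
  qed
qed

section \<open>The coefficients of functions in the class\<close>

text \<open>
  Here \<open>d1 / 2\<close>, \<open>d2 / 3 + d0\<^sup>2\<close> and \<open>d3 / 4 + d0 * d1\<close> are the coefficients \<open>a\<^sub>4\<close>, \<open>a\<^sub>5\<close> and
  \<open>a\<^sub>6\<close>. With \<open>s = 1 - |d0|\<^sup>2\<close> the triangle inequality gives the bound
  \<open>5 / 8 * s\<^sup>2 + (1 - 2 / 3 * s)\<^sup>2\<close>. Its linear term is negative because \<open>|d2| \<le> s\<close>, which keeps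
  the bound below 1; an estimate of \<open>|d2|\<close> of order \<open>sqrt s\<close>, as from
  \<open>|d0|\<^sup>2 + |d2|\<^sup>2 \<le> 1\<close>, would fail near \<open>s = 0\<close>.
\<close>

lemma hankel_bound:
  fixes d0 d1 d2 d3 :: complex
  assumes "norm d0 \<le> 1" "norm d1 \<le> 1 - (norm d0)\<^sup>2" "norm d2 \<le> 1 - (norm d0)\<^sup>2"
    "norm d3 \<le> 1 - (norm d0)\<^sup>2"
  shows "norm (d1 / 2 * (d3 / 4 + d0 * d1) - (d2 / 3 + d0\<^sup>2)\<^sup>2) \<le> 1"
proof -
  define s where "s = 1 - (norm d0)\<^sup>2"
  have s: "0 \<le> s" "s \<le> 1" using assms(1) by (auto simp: s_def power_le_one)
  have "norm (d1 / 2 * (d3 / 4 + d0 * d1)) \<le> s / 2 * (s / 4 + 1 * s)"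
  proof -
    have "norm (d3 / 4 + d0 * d1) \<le> norm (d3 / 4) + norm (d0 * d1)" by (rule norm_triangle_ineq)
    also have "\<dots> \<le> s / 4 + 1 * s"
      unfolding norm_mult by (intro add_mono mult_mono) (use assms s in \<open>auto simp: s_def norm_divide\<close>)
    finally show ?thesis
      unfolding norm_mult by (intro mult_mono) (use assms s in \<open>auto simp: s_def norm_divide\<close>)
  qed
  moreover have "norm ((d2 / 3 + d0\<^sup>2)\<^sup>2) \<le> (s / 3 + (1 - s))\<^sup>2"
  proof -
    have "norm (d2 / 3 + d0\<^sup>2) \<le> norm (d2 / 3) + norm (d0\<^sup>2)" by (rule norm_triangle_ineq)
    also have "\<dots> \<le> s / 3 + (1 - s)"
      using assms by (auto simp: s_def norm_divide norm_power)
    finally show ?thesis unfolding norm_power by (intro power_mono) auto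
  qed
  moreover have "s / 2 * (s / 4 + 1 * s) + (s / 3 + (1 - s))\<^sup>2 \<le> 1"
  proof -
    have "1 - (s / 2 * (s / 4 + 1 * s) + (s / 3 + (1 - s))\<^sup>2) = s * (4 / 3 - 77 / 72 * s)"
      by (simp add: power2_eq_square field_simps)
    also have "\<dots> \<ge> 0" using s by (intro mult_nonneg_nonneg) auto
    finally show ?thesis by linarith
  qed
  ultimately show ?thesis
    using norm_triangle_ineq4[of "d1 / 2 * (d3 / 4 + d0 * d1)" "(d2 / 3 + d0\<^sup>2)\<^sup>2"] by linarith
qed

text \<open>
  With \<open>p z = z / f z\<close>, the derivative of \<open>f z * p z = z\<close> reads
  \<open>f z * deriv p z + deriv f z * p z = 1\<close>; multiply by \<open>p z\<close>. Stated through the product, this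
  includes the point \<open>z = 0\<close>.
\<close>

lemma class_U_expression:
  assumes f: "f field_differentiable at z" and p: "p field_differentiable at z"
    and fp: "\<forall>\<^sub>F z in nhds z. f z * p z = z"
  shows "(p z)\<^sup>2 * deriv f z = p z - z * deriv p z"
proof -
  have "((\<lambda>z. f z * p z) has_field_derivative f z * deriv p z + deriv f z * p z) (at z)"
    using DERIV_mult[OF field_differentiable_derivI[OF f] field_differentiable_derivI[OF p]]
    by (simp add: ac_simps)
  then have "deriv (\<lambda>z. f z * p z) z = f z * deriv p z + deriv f z * p z" by (rule DERIV_imp_deriv)
  moreover have "deriv (\<lambda>z. f z * p z) z = deriv (\<lambda>z. z) z" by (rule deriv_cong_ev[OF fp refl])
  ultimately have "f z * deriv p z + deriv f z * p z = 1" by simp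
  moreover have "f z * p z = z" using eventually_nhds_x_imp_x[OF fp] .
  ultimately show ?thesis by algebra
qed

lemma class_U_reciprocal:
  assumes f: "f \<in> class_U"
  obtains g where "g holomorphic_on ball 0 1" "\<And>z. f z = z * g z" "g 0 = 1"
    "\<And>z. norm z < 1 \<Longrightarrow> g z \<noteq> 0" "\<And>z. norm z < 1 \<Longrightarrow> id_over f z = 1 / g z"
proof
  define g where "g = (\<lambda>z. if z = 0 then deriv f 0 else f z / z)"
  have hol: "f holomorphic_on ball 0 1" and f0: "f 0 = 0" and f1: "deriv f 0 = 1"
    using f by (auto simp: class_U_def class_A_def analytic_imp_holomorphic)
  show "g holomorphic_on ball 0 1"
    using pole_lemma_open[OF hol, of 0] by (simp add: g_def f0 cong: if_cong)
  show "f z = z * g z" for z by (simp add: g_def f0)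
  show "g 0 = 1" by (simp add: g_def f1)
  fix z :: complex assume "norm z < 1"
  then show "g z \<noteq> 0" using f by (auto simp: g_def f1 class_U_def)
  show "id_over f z = 1 / g z" by (simp add: g_def f1 id_over_def)
qed

text \<open>
  In the application \<open>G\<close> is the series of \<open>f z / z\<close>, so \<open>fps_nth G n\<close> is the Taylor coefficient
  \<open>a\<close> of index \<open>n + 1\<close>, and the assumption on \<open>fps_nth G 1\<close> says \<open>a\<^sub>2 = 0\<close>.
\<close>

lemma fps_reciprocal_coeffs:
  fixes G P :: "complex fps"
  assumes GP: "G * P = 1" and G0: "fps_nth G 0 = 1" and G1: "fps_nth G 1 = 0"
  shows "fps_nth P 0 = 1" "fps_nth P 1 = 0" "fps_nth G 3 = - fps_nth P 3"
    "fps_nth G 4 = (fps_nth P 2)\<^sup>2 - fps_nth P 4"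
    "fps_nth G 5 = 2 * fps_nth P 2 * fps_nth P 3 - fps_nth P 5"
proof -
  have n: "(\<Sum>i=0..n. fps_nth G i * fps_nth P (n - i)) = (if n = 0 then 1 else 0)" for n
    using arg_cong[OF GP, of "\<lambda>F. fps_nth F n"] by (simp add: fps_mult_nth)
  show P0: "fps_nth P 0 = 1" using n[of 0] G0 by simp
  show P1: "fps_nth P 1 = 0" using n[of 1] G0 G1 P0 by simp
  note * = numeral_eq_Suc sum.atLeast0_atMost_Suc
  have 2: "fps_nth G 2 = - fps_nth P 2"
    using n[of 2] G0 G1 P0 P1 by (simp add: * add_eq_0_iff)
  show 3: "fps_nth G 3 = - fps_nth P 3"
    using n[of 3] G0 G1 P0 P1 by (simp add: * add_eq_0_iff)
  show 4: "fps_nth G 4 = (fps_nth P 2)\<^sup>2 - fps_nth P 4"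
    using n[of 4] G0 G1 P0 P1 2 by (simp add: * ) (simp add: algebra_simps add_eq_0_iff)
  show 5: "fps_nth G 5 = 2 * fps_nth P 2 * fps_nth P 3 - fps_nth P 5"
    using n[of 5] G0 G1 P0 P1 2 3 by (simp add: * ) (simp add: algebra_simps add_eq_0_iff)
qed

lemma class_U_hankel_bound:
  assumes f: "f \<in> class_U" and a2: "taylor_coeff f 2 = 0"
  shows "norm (hankel2 4 f) \<le> 1"
proof -
  obtain g where g: "g holomorphic_on ball 0 1" and fg: "\<And>z. f z = z * g z" and g0: "g 0 = 1"
    and gnz: "\<And>z. norm z < 1 \<Longrightarrow> g z \<noteq> 0"
    and gi: "\<And>z. norm z < 1 \<Longrightarrow> id_over f z = 1 / g z"
    using class_U_reciprocal[OF f] by blast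
  have hol: "f holomorphic_on ball 0 1"
    using f by (simp add: class_U_def class_A_def analytic_imp_holomorphic)
  define p where "p = (\<lambda>z. 1 / g z)"
  have p: "p holomorphic_on ball 0 1" unfolding p_def by (intro holomorphic_intros g) (use gnz in auto)
  \<comment> \<open>The quantity bounded by 1 in the definition of the class. Besides the constant coefficient \<open>p\<^sub>0 - 1\<close>
      also the linear one, \<open>(1 - 1) * p\<^sub>1\<close>, is 0.\<close>
  define w where "w = (\<lambda>z. p z - z * deriv p z - 1)"
  have w: "w holomorphic_on ball 0 1"
    unfolding w_def by (intro holomorphic_intros p) auto
  have wb: "norm (w z) \<le> 1" if z: "norm z < 1" for z
  proof -
    have "\<forall>\<^sub>F u in nhds z. u \<in> ball 0 1" by (rule eventually_nhds_in_open) (use z in auto)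
    then have "\<forall>\<^sub>F u in nhds z. f u * p u = u"
      by eventually_elim (use gnz in \<open>auto simp: fg p_def\<close>)
    then have "(p z)\<^sup>2 * deriv f z = p z - z * deriv p z"
      using hol p z
      by (intro class_U_expression) (auto intro: holomorphic_on_imp_differentiable_at)
    moreover have "norm ((id_over f z)\<^sup>2 * deriv f z - 1) < 1" using f z by (simp add: class_U_def)
    ultimately show ?thesis using gi[OF z] by (simp add: w_def p_def)
  qed
  define G where "G = fps_expansion g 0"
  define P where "P = fps_expansion p 0"
  have G: "g has_fps_expansion G" and P: "p has_fps_expansion P"
    unfolding G_def P_def using g p by (auto intro: has_fps_expansion_fps_expansion_unit_disc)
  have "(\<lambda>z. z * g z) has_fps_expansion fps_X * G" by (intro fps_expansion_intros G)
  then have "f has_fps_expansion fps_X * G" using fg by (metis (no_types, lifting) ext)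
  then have a: "taylor_coeff f n = fps_nth (fps_X * G) n" for n
    unfolding taylor_coeff_def by (simp add: fps_expansion_eqI)
  have G0: "fps_nth G 0 = 1" using has_fps_expansion_imp_0_eq_fps_nth_0[OF G] g0 by simp
  have G1: "fps_nth G 1 = 0" using a2 by (simp add: a)
  have expGP: "(\<lambda>z. g z * p z) has_fps_expansion G * P" by (intro fps_expansion_intros G P)
  have "\<forall>\<^sub>F z in nhds 0. g z * p z = 1"
  proof -
    have "\<forall>\<^sub>F z in nhds (0::complex). z \<in> ball 0 1" by (rule eventually_nhds_in_open) auto
    then show ?thesis by eventually_elim (use gnz in \<open>auto simp: p_def\<close>)
  qed
  from iffD1[OF has_fps_expansion_cong[OF this refl] expGP]
  have "(\<lambda>z. 1) has_fps_expansion G * P" .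
  then have "G * P = 1" using fps_expansion_unique_complex has_fps_expansion_1 by blast
  note co = fps_reciprocal_coeffs[OF this G0 G1]
  define W where "W = P - fps_X * fps_deriv P - 1"
  have W: "w has_fps_expansion W"
    unfolding w_def W_def by (intro fps_expansion_intros P)
  have Wn: "fps_nth W (Suc n) = - of_nat n * fps_nth P (Suc n)" for n
    by (simp add: W_def algebra_simps)
  have "p 0 = 1" by (simp add: p_def g0)
  then have w0: "w 0 = 0" by (simp add: w_def)
  obtain u where u: "u holomorphic_on ball 0 1" "\<And>z. norm z < 1 \<Longrightarrow> norm (u z) \<le> 1"
    "\<And>z. w z = z * u z" "u 0 = deriv w 0" by (rule schwarz_division[OF w w0 wb]) blast+
  have "deriv w 0 = fps_nth W 1" using fps_nth_fps_expansion[OF W, of 1] by simp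
  then have u0: "u 0 = 0" using u(4) Wn[of 0] by simp
  obtain v where v: "v holomorphic_on ball 0 1" "\<And>z. norm z < 1 \<Longrightarrow> norm (v z) \<le> 1"
    "\<And>z. u z = z * v z" by (rule schwarz_division[OF u(1) u0 u(2)]) blast+
  define D where "D = fps_expansion v 0"
  have D: "v has_fps_expansion D"
    unfolding D_def using v(1) by (rule has_fps_expansion_fps_expansion_unit_disc)
  have "(\<lambda>z. z * (z * v z)) has_fps_expansion fps_X * (fps_X * D)"
    by (intro fps_expansion_intros D)
  moreover have "(\<lambda>z. z * (z * v z)) = w" using u(3) v(3) by auto
  ultimately have "fps_X * (fps_X * D) = W" using W fps_expansion_unique_complex by metis
  then have Dn: "fps_nth D n = - of_nat (Suc n) * fps_nth P (Suc (Suc n))" for n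
    using Wn[of "Suc n"] by (auto dest!: arg_cong[of _ _ "\<lambda>F. fps_nth F (Suc (Suc n))"])
  have P2: "fps_nth P 2 = - fps_nth D 0" using Dn[of 0] by (simp add: numeral_eq_Suc)
  have P3: "fps_nth P 3 = - fps_nth D 1 / 2" using Dn[of 1] by (simp add: numeral_eq_Suc)
  have P4: "fps_nth P 4 = - fps_nth D 2 / 3" using Dn[of 2] by (simp add: numeral_eq_Suc)
  have P5: "fps_nth P 5 = - fps_nth D 3 / 4" using Dn[of 3] by (simp add: numeral_eq_Suc)
  have "hankel2 4 f = fps_nth G 3 * fps_nth G 5 - (fps_nth G 4)\<^sup>2"
    by (simp add: hankel2_def a)
  also have "\<dots> = fps_nth D 1 / 2 * (fps_nth D 3 / 4 + fps_nth D 0 * fps_nth D 1)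
      - (fps_nth D 2 / 3 + (fps_nth D 0)\<^sup>2)\<^sup>2"
    by (simp add: co P2 P3 P4 P5 algebra_simps)
  finally show ?thesis
    using hankel_bound norm_fps_nth_le_1[OF v(1,2) D] norm_fps_nth_le[OF v(1,2) D] by simp
qed

section \<open>The extremal function\<close>

lemma square_ne_one_unit_disc:
  fixes z :: complex
  assumes "norm z < 1"
  shows "1 - z\<^sup>2 \<noteq> 0"
proof
  assume "1 - z\<^sup>2 = 0"
  then have "norm z ^ 2 = 1" by (metis eq_iff_diff_eq_0 norm_one norm_power)
  then show False using assms norm_ge_zero[of z] by (auto simp: power2_eq_1_iff)
qed

lemma extremal_sums:
  fixes z :: complex
  assumes "norm z < 1"
  shows "(\<lambda>n. z ^ (2 * n + 1)) sums (z / (1 - z\<^sup>2))"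
proof -
  have "norm (z\<^sup>2) < 1" using assms by (simp add: norm_power power_less_one_iff)
  then have "(\<lambda>n. z * (z\<^sup>2) ^ n) sums (z * (1 / (1 - z\<^sup>2)))"
    by (intro sums_mult geometric_sums)
  then show ?thesis by (simp add: power_mult)
qed

lemma extremal_in_class_U: "(\<lambda>z::complex. z / (1 - z\<^sup>2)) \<in> class_U"
proof -
  define g where "g = (\<lambda>z::complex. z / (1 - z\<^sup>2))"
  note nz = square_ne_one_unit_disc
  have hol: "g holomorphic_on ball 0 1"
    unfolding g_def by (intro holomorphic_intros) (use nz in auto)
  have p: "id_over g z = 1 - z\<^sup>2" if "norm z < 1" for z
    using nz[OF that] by (simp add: id_over_def g_def)
  have expr: "(1 - z\<^sup>2)\<^sup>2 * deriv g z = 1 + z\<^sup>2" if z: "norm z < 1" for z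
  proof -
    have "\<forall>\<^sub>F u in nhds z. u \<in> ball 0 1" by (rule eventually_nhds_in_open) (use z in auto)
    then have "\<forall>\<^sub>F u in nhds z. g u * (1 - u\<^sup>2) = u"
      by eventually_elim (use nz in \<open>auto simp: g_def\<close>)
    then have "(1 - z\<^sup>2)\<^sup>2 * deriv g z = (1 - z\<^sup>2) - z * deriv (\<lambda>z. 1 - z\<^sup>2) z"
      using hol z
      by (intro class_U_expression) (auto intro!: holomorphic_on_imp_differentiable_at derivative_intros)
    moreover have "deriv (\<lambda>z. 1 - z\<^sup>2) z = - 2 * z"
      by (rule DERIV_imp_deriv) (auto intro!: derivative_eq_intros)
    ultimately show ?thesis by (simp add: power2_eq_square)
  qed
  have "g \<in> class_U"
    unfolding class_U_def class_A_def
  proof (intro CollectI conjI ballI)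
    show "g analytic_on ball 0 1" using hol by (simp add: analytic_on_open)
    show "g 0 = 0" by (simp add: g_def)
    show "deriv g 0 = 1" using expr[of 0] by simp
  next
    fix z :: complex assume "z \<in> ball 0 1 - {0}"
    then show "g z \<noteq> 0" using nz[of z] by (simp add: g_def)
  next
    fix z :: complex assume "z \<in> ball 0 1"
    then show "norm ((id_over g z)\<^sup>2 * deriv g z - 1) < 1"
      by (simp add: p expr norm_power power_less_one_iff)
  qed
  then show ?thesis by (simp add: g_def)
qed

text \<open>
  The series of odd powers solves \<open>A * (1 - X\<^sup>2) = X\<close>, which determines it.
\<close>

lemma extremal_taylor_coeff:
  "taylor_coeff (\<lambda>z::complex. z / (1 - z\<^sup>2)) n = (if odd n then 1 else 0)"
proof -
  define A :: "complex fps" where "A = Abs_fps (\<lambda>n. if odd n then 1 else 0)"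
  have "A * (1 - fps_X\<^sup>2) = fps_X"
  proof (rule fps_ext)
    fix n show "fps_nth (A * (1 - fps_X\<^sup>2)) n = fps_nth (fps_X :: complex fps) n"
      by (cases "n < 2") (auto simp: A_def ring_distribs fps_X_power_mult_right_nth less_2_cases_iff)
  qed
  moreover have "(1 - fps_X\<^sup>2 :: complex fps) \<noteq> 0"
  proof
    assume "(1 - fps_X\<^sup>2 :: complex fps) = 0"
    then have "fps_nth (1 - fps_X\<^sup>2 :: complex fps) 0 = fps_nth 0 0" by (rule arg_cong)
    then show False by simp
  qed
  ultimately have A: "A = fps_X / (1 - fps_X\<^sup>2)" by (metis nonzero_mult_div_cancel_right)
  have "(\<lambda>z::complex. z / (1 - z\<^sup>2)) has_fps_expansion fps_X / (1 - fps_X\<^sup>2)"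
    by (intro fps_expansion_intros) auto
  then show ?thesis
    unfolding taylor_coeff_def by (simp add: fps_expansion_eqI flip: A) (simp add: A_def)
qed

theorem theorem2:
  shows "(\<forall>f\<in>class_U. taylor_coeff f 2 = 0 \<longrightarrow> norm (hankel2 4 f) \<le> 1) \<and>
    (let g = (\<lambda>z::complex. z / (1 - z\<^sup>2)) in
       (\<forall>z\<in>ball 0 1. (\<lambda>n. z ^ (2 * n + 1)) sums g z) \<and>
       g \<in> class_U \<and> taylor_coeff g 2 = 0 \<and> norm (hankel2 4 g) = 1)"
  unfolding Let_def
  using class_U_hankel_bound extremal_sums extremal_in_class_U
  by (simp add: extremal_taylor_coeff hankel2_def)

end
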